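(* Let $n\ge1$ be an integer, $p$ an odd integer, $\mu=\mu_{1/(2n)}$, and suppose that both $E(\Gamma)=\{e_\gamma:\gamma\in\Gamma\}$ and $E(p\Gamma)=\{e_{p\gamma}:\gamma\in\Gamma\}$ are orthonormal bases of $L^2(\mu)$. Let $U$ be the unitary operator on $L^2(\mu)$ determined by $Ue_\gamma=e_{p\gamma}$, and $S_0,S_1$ the isometries determined by $S_0e_\gamma=e_{2n\gamma}$, $S_1e_\gamma=e_{\frac n2+2n\gamma}$, for $\gamma\in\Gamma$. Suppose $n$ is odd and $\gamma\in\Gamma$. Write $S_0Ue_\gamma=s+w$, where $s\in S_0^2(L^2(\mu))$ and $w\in W_1=S_0S_1(L^2(\mu))$. Then $$US_0e_\gamma=\begin{cases}s-w&\text{if }\gamma\in2n\Gamma,\\-s+w&\text{if }\gamma\in\frac n2+2n\Gamma.\end{cases}$$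
   Context: For $\lambda\in(0,1)$, $\mu_\lambda$ is the unique Borel probability measure on $\mathbb{R}$ satisfying $\mu_\lambda=\frac12\mu_\lambda\circ\tau_+^{-1}+\frac12\mu_\lambda\circ\tau_-^{-1}$, where $\tau_\pm(x)=\lambda(x\pm1)$. For $t\in\mathbb{R}$, $e_t(x)=e^{2\pi i t x}$ in $L^2(\mu)$. $\Gamma=\{\sum_{i=0}^m a_i(2n)^i: m\ge0,\ a_i\in\{0,\frac n2\}\}$, which satisfies $\Gamma=2n\Gamma\sqcup(\frac n2+2n\Gamma)$. The range $S_0(L^2(\mu))$ is the orthogonal direct sum of $S_0^2(L^2(\mu))$ and $W_1$, so $s$ and $w$ exist and are unique. *)

theory Defs
  imports "HOL-Probability.Probability"
begin

text \<open>The defining property of \<open>\<mu>\<^sub>\<lambda>\<close>; since this measure is unique, a measure \<open>M\<close> with this property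
  is \<open>\<mu>\<^sub>\<lambda>\<close>. The image measure \<open>\<mu> \<circ> \<tau>\<inverse>\<close> is \<^const>\<open>distr\<close>.\<close>

definition bernoulli_convolution :: "real \<Rightarrow> real measure \<Rightarrow> bool" where
  "bernoulli_convolution l M \<longleftrightarrow>
     prob_space M \<and> sets M = sets borel \<and>
     (\<forall>A\<in>sets borel. measure M A =
        1/2 * measure (distr M borel (\<lambda>x. l * (x + 1))) A +
        1/2 * measure (distr M borel (\<lambda>x. l * (x - 1))) A)"

text \<open>Elements of \<open>L\<^sup>2(M)\<close> are given by square integrable representatives; two representatives denote
  the same element iff they agree almost everywhere. Equations in \<open>L\<^sup>2(M)\<close> are therefore always
  stated almost everywhere.\<close>

definition L2_space :: "'a measure \<Rightarrow> ('a \<Rightarrow> complex) set" where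
  "L2_space M = {f \<in> borel_measurable M. integrable M (\<lambda>x. (cmod (f x))\<^sup>2)}"

definition L2_inner :: "'a measure \<Rightarrow> ('a \<Rightarrow> complex) \<Rightarrow> ('a \<Rightarrow> complex) \<Rightarrow> complex" where
  "L2_inner M f g = (LINT x|M. f x * cnj (g x))"

definition L2_norm :: "'a measure \<Rightarrow> ('a \<Rightarrow> complex) \<Rightarrow> real" where
  "L2_norm M f = sqrt (LINT x|M. (cmod (f x))\<^sup>2)"

text \<open>An orthonormal set whose finite linear combinations are dense. The set consists of
  representatives; two distinct ones that agree almost everywhere are excluded by orthogonality.\<close>

definition L2_orthonormal_basis :: "'a measure \<Rightarrow> ('a \<Rightarrow> complex) set \<Rightarrow> bool" where
  "L2_orthonormal_basis M B \<longleftrightarrow>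
     B \<subseteq> L2_space M \<and>
     (\<forall>f\<in>B. \<forall>g\<in>B. L2_inner M f g = (if f = g then 1 else 0)) \<and>
     (\<forall>f\<in>L2_space M. \<forall>\<epsilon>>0. \<exists>F c. finite F \<and> F \<subseteq> B \<and>
        L2_norm M (\<lambda>x. f x - (\<Sum>g\<in>F. c g * g x)) < \<epsilon>)"

text \<open>The second conjunct makes the operator well defined on almost-everywhere classes.\<close>

definition L2_linear :: "'a measure \<Rightarrow> (('a \<Rightarrow> complex) \<Rightarrow> ('a \<Rightarrow> complex)) \<Rightarrow> bool" where
  "L2_linear M T \<longleftrightarrow>
     (\<forall>f\<in>L2_space M. T f \<in> L2_space M) \<and>
     (\<forall>f\<in>L2_space M. \<forall>g\<in>L2_space M.
        (AE x in M. f x = g x) \<longrightarrow> (AE x in M. T f x = T g x)) \<and>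
     (\<forall>f\<in>L2_space M. \<forall>g\<in>L2_space M. AE x in M. T (\<lambda>y. f y + g y) x = T f x + T g x) \<and>
     (\<forall>f\<in>L2_space M. \<forall>c. AE x in M. T (\<lambda>y. c * f y) x = c * T f x)"

definition L2_isometry :: "'a measure \<Rightarrow> (('a \<Rightarrow> complex) \<Rightarrow> ('a \<Rightarrow> complex)) \<Rightarrow> bool" where
  "L2_isometry M T \<longleftrightarrow> L2_linear M T \<and> (\<forall>f\<in>L2_space M. L2_norm M (T f) = L2_norm M f)"

definition L2_range :: "'a measure \<Rightarrow> (('a \<Rightarrow> complex) \<Rightarrow> ('a \<Rightarrow> complex)) \<Rightarrow> ('a \<Rightarrow> complex) set" where
  "L2_range M T = {g \<in> L2_space M. \<exists>f\<in>L2_space M. AE x in M. g x = T f x}"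

definition L2_unitary :: "'a measure \<Rightarrow> (('a \<Rightarrow> complex) \<Rightarrow> ('a \<Rightarrow> complex)) \<Rightarrow> bool" where
  "L2_unitary M T \<longleftrightarrow> L2_linear M T \<and>
     (\<forall>f\<in>L2_space M. \<forall>g\<in>L2_space M. L2_inner M (T f) (T g) = L2_inner M f g) \<and>
     L2_range M T = L2_space M"

definition expo :: "real \<Rightarrow> real \<Rightarrow> complex" where
  "expo t = (\<lambda>x. exp (2 * of_real pi * \<i> * of_real t * of_real x))"

definition Gam :: "nat \<Rightarrow> real set" where
  "Gam n = {\<Sum>i\<le>m. a i * (2 * real n) ^ i | (m::nat) (a :: nat \<Rightarrow> real).
              \<forall>i\<le>m. a i \<in> {0, real n / 2}}"

end

theory Submission
  imports Defs
begin

text \<open>Write \<open>\<tau>\<^sub>\<sigma> y = (y + \<sigma>) / 2n\<close> for \<open>\<sigma> = \<plusminus>1\<close>. Since \<open>e\<^bsub>2nt\<^esub>(\<tau>\<^sub>\<sigma> y) = e\<^sub>t(\<sigma>) e\<^sub>t(y)\<close> and, for odd \<open>n\<close>,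
  \<open>e\<^sub>t(\<sigma>)\<close> equals \<open>1\<close> on \<open>2n\<Gamma>\<close> and \<open>-1\<close> on \<open>n/2 + 2n\<Gamma>\<close>, density of the exponentials gives
  \<open>(S\<^sub>0 h) \<circ> \<tau>\<^sub>\<sigma> = h\<close> on the range of \<open>S\<^sub>0\<close> and \<open>(S\<^sub>0 h) \<circ> \<tau>\<^sub>\<sigma> = -h\<close> on the range of \<open>S\<^sub>1\<close>. If
  \<open>s = S\<^sub>0S\<^sub>0f\<close> and \<open>w = S\<^sub>0S\<^sub>1g\<close>, then injectivity of \<open>S\<^sub>0\<close> gives \<open>e\<^bsub>p\<gamma>\<^esub> = S\<^sub>0f + S\<^sub>1g\<close>, so that
  \<open>(s - w) \<circ> \<tau>\<^sub>\<sigma> = e\<^bsub>p\<gamma>\<^esub>\<close>. As \<open>p\<close> is odd, \<open>e\<^bsub>2np\<gamma>\<^esub> \<circ> \<tau>\<^sub>\<sigma> = \<plusminus>e\<^bsub>p\<gamma>\<^esub>\<close> with the same two signs. Finally, by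
  self-similarity an identity holds almost everywhere as soon as it does so after composition with
  both \<open>\<tau>\<^sub>\<sigma>\<close>.\<close>

section \<open>Square integrable representatives: closure properties and norm estimates\<close>

lemma L2_space_add:
  assumes "f \<in> L2_space M" "g \<in> L2_space M"
  shows "(\<lambda>x. f x + g x) \<in> L2_space M"
    and "(L2_norm M (\<lambda>x. f x + g x))\<^sup>2 \<le> 2 * (L2_norm M f)\<^sup>2 + 2 * (L2_norm M g)\<^sup>2"
proof -
  have [measurable]: "f \<in> borel_measurable M" "g \<in> borel_measurable M"
    and int: "integrable M (\<lambda>x. (cmod (f x))\<^sup>2)" "integrable M (\<lambda>x. (cmod (g x))\<^sup>2)"
    using assms by (auto simp: L2_space_def)
  \<comment> \<open>The factors 2 come from 2ab \<le> a^2 + b^2. Such a crude pointwise bound is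
    enough, since only boundedness of operators is needed later, not the sharp triangle
    inequality.\<close>
  have bound: "(cmod (f x + g x))\<^sup>2 \<le> 2 * (cmod (f x))\<^sup>2 + 2 * (cmod (g x))\<^sup>2" for x
  proof -
    have "(cmod (f x + g x))\<^sup>2 \<le> (cmod (f x) + cmod (g x))\<^sup>2"
      by (intro power_mono norm_triangle_ineq) auto
    also have "\<dots> \<le> 2 * (cmod (f x))\<^sup>2 + 2 * (cmod (g x))\<^sup>2"
      using sum_squares_bound[of "cmod (f x)" "cmod (g x)"] by (simp add: power2_sum)
    finally show ?thesis .
  qed
  have intb: "integrable M (\<lambda>x. 2 * (cmod (f x))\<^sup>2 + 2 * (cmod (g x))\<^sup>2)"
    using int by auto
  have sum_int: "integrable M (\<lambda>x. (cmod (f x + g x))\<^sup>2)"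
    by (rule Bochner_Integration.integrable_bound[OF intb]) (use bound in auto)
  then show "(\<lambda>x. f x + g x) \<in> L2_space M" by (simp add: L2_space_def)
  have "(LINT x|M. (cmod (f x + g x))\<^sup>2) \<le> (LINT x|M. 2 * (cmod (f x))\<^sup>2 + 2 * (cmod (g x))\<^sup>2)"
    by (rule integral_mono[OF sum_int intb bound])
  also have "\<dots> = 2 * (LINT x|M. (cmod (f x))\<^sup>2) + 2 * (LINT x|M. (cmod (g x))\<^sup>2)"
    using int by simp
  finally show "(L2_norm M (\<lambda>x. f x + g x))\<^sup>2 \<le> 2 * (L2_norm M f)\<^sup>2 + 2 * (L2_norm M g)\<^sup>2"
    by (simp add: L2_norm_def)
qed

lemma L2_space_mult:
  assumes "f \<in> L2_space M"
  shows "(\<lambda>x. c * f x) \<in> L2_space M" and "L2_norm M (\<lambda>x. c * f x) = cmod c * L2_norm M f"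
  using assms
  by (auto simp: L2_space_def L2_norm_def norm_mult power_mult_distrib real_sqrt_mult)

lemma L2_space_diff:
  assumes "f \<in> L2_space M" "g \<in> L2_space M"
  shows "(\<lambda>x. f x - g x) \<in> L2_space M"
  using L2_space_add(1)[OF assms(1) L2_space_mult(1)[OF assms(2), of "-1"]] by simp

lemma L2_space_sum:
  assumes "finite F" "F \<subseteq> L2_space M"
  shows "(\<lambda>x. \<Sum>g\<in>F. c g * g x) \<in> L2_space M"
  using assms
proof (induction F rule: finite_induct)
  case empty
  then show ?case by (simp add: L2_space_def)
next
  case (insert g F)
  then have "(\<lambda>x. c g * g x + (\<Sum>g\<in>F. c g * g x)) \<in> L2_space M"
    by (intro L2_space_add L2_space_mult) auto
  with insert show ?case by simp
qed

lemma L2_norm_nonneg: "0 \<le> L2_norm M f"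
  by (simp add: L2_norm_def)

lemma L2_norm_cong_AE:
  assumes "f \<in> L2_space M" "g \<in> L2_space M" "AE x in M. f x = g x"
  shows "L2_norm M f = L2_norm M g"
proof -
  have [measurable]: "f \<in> borel_measurable M" "g \<in> borel_measurable M"
    using assms by (auto simp: L2_space_def)
  have "(LINT x|M. (cmod (f x))\<^sup>2) = (LINT x|M. (cmod (g x))\<^sup>2)"
    by (rule integral_cong_AE) (use assms(3) in auto)
  then show ?thesis by (simp add: L2_norm_def)
qed

lemma L2_norm_eq_0_imp_AE:
  assumes "f \<in> L2_space M" "L2_norm M f = 0"
  shows "AE x in M. f x = 0"
proof -
  have int: "integrable M (\<lambda>x. (cmod (f x))\<^sup>2)" using assms by (auto simp: L2_space_def)
  have "(LINT x|M. (cmod (f x))\<^sup>2) = 0" using assms by (simp add: L2_norm_def)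
  then have "AE x in M. (cmod (f x))\<^sup>2 = 0"
    by (subst (asm) integral_nonneg_eq_0_iff_AE[OF int]) auto
  then show ?thesis by auto
qed

section \<open>Linear operators on almost-everywhere classes\<close>

lemma
  assumes T: "L2_linear M T"
  shows L2_linear_space: "f \<in> L2_space M \<Longrightarrow> T f \<in> L2_space M"
    and L2_linear_cong_AE: "f \<in> L2_space M \<Longrightarrow> g \<in> L2_space M \<Longrightarrow> AE x in M. f x = g x \<Longrightarrow>
      AE x in M. T f x = T g x"
    and L2_linear_add_AE: "f \<in> L2_space M \<Longrightarrow> g \<in> L2_space M \<Longrightarrow>
      AE x in M. T (\<lambda>y. f y + g y) x = T f x + T g x"
    and L2_linear_mult_AE: "f \<in> L2_space M \<Longrightarrow> AE x in M. T (\<lambda>y. c * f y) x = c * T f x"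
  using T by (simp_all add: L2_linear_def)

lemma L2_linear_diff_AE:
  assumes "L2_linear M T" "f \<in> L2_space M" "g \<in> L2_space M"
  shows "AE x in M. T (\<lambda>y. f y - g y) x = T f x - T g x"
proof -
  have "AE x in M. T (\<lambda>y. (f y - g y) + g y) x = T (\<lambda>y. f y - g y) x + T g x"
    by (intro L2_linear_add_AE L2_space_diff assms)
  then show ?thesis by eventually_elim simp
qed

lemma L2_linear_sum_eq_0_AE:
  assumes T: "L2_linear M T" and "finite F" "F \<subseteq> L2_space M"
    and "\<And>g. g \<in> F \<Longrightarrow> AE x in M. T g x = 0"
  shows "AE x in M. T (\<lambda>y. \<Sum>g\<in>F. c g * g y) x = 0"
  using assms(2-)
proof (induction F rule: finite_induct)
  case empty
  have "(\<lambda>y. 0) \<in> L2_space M" by (simp add: L2_space_def)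
  \<comment> \<open>Homogeneity with scalar 0: as \<open>T\<close> is linear only almost everywhere,
    the image of the zero function need not vanish at every point.\<close>
  then have "AE x in M. T (\<lambda>y. 0 * 0) x = 0 * T (\<lambda>y. 0) x"
    by (rule L2_linear_mult_AE[OF T])
  then show ?case by simp
next
  case (insert g F)
  have g: "g \<in> L2_space M" and F: "F \<subseteq> L2_space M" using insert by auto
  have "AE x in M. T (\<lambda>y. c g * g y + (\<Sum>g\<in>F. c g * g y)) x
      = T (\<lambda>y. c g * g y) x + T (\<lambda>y. \<Sum>g\<in>F. c g * g y) x"
    by (intro L2_linear_add_AE T L2_space_mult g L2_space_sum insert(1) F)
  moreover have "AE x in M. T (\<lambda>y. c g * g y) x = c g * T g x"
    by (rule L2_linear_mult_AE[OF T g])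
  moreover have "AE x in M. T g x = 0" using insert by auto
  moreover have "AE x in M. T (\<lambda>y. \<Sum>g\<in>F. c g * g y) x = 0" using insert by auto
  ultimately have "AE x in M. T (\<lambda>y. c g * g y + (\<Sum>g\<in>F. c g * g y)) x = 0"
    by eventually_elim simp
  with insert show ?case by simp
qed

lemma L2_orthonormal_basis_approx:
  assumes "L2_orthonormal_basis M B" "f \<in> L2_space M" "\<epsilon> > 0"
  obtains F c where "finite F" "F \<subseteq> B" "L2_norm M (\<lambda>x. f x - (\<Sum>g\<in>F. c g * g x)) < \<epsilon>"
proof -
  have "\<exists>F c. finite F \<and> F \<subseteq> B \<and> L2_norm M (\<lambda>x. f x - (\<Sum>g\<in>F. c g * g x)) < \<epsilon>"
    using assms by (simp add: L2_orthonormal_basis_def)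
  then show thesis by (elim exE conjE) (rule that)
qed

text \<open>Density argument: \<open>T\<close> vanishes on finite combinations of basis elements,
  and the bound carries this over to limits. Nothing is assumed about the sign of \<open>K\<close>,
  hence the absolute values in the proof.\<close>

lemma L2_bounded_linear_eq_0_AE:
  assumes B: "L2_orthonormal_basis M B" and T: "L2_linear M T" and f: "f \<in> L2_space M"
    and bound: "\<And>f. f \<in> L2_space M \<Longrightarrow> L2_norm M (T f) \<le> K * L2_norm M f"
    and zero: "\<And>e. e \<in> B \<Longrightarrow> AE x in M. T e x = 0"
  shows "AE x in M. T f x = 0"
proof (rule L2_norm_eq_0_imp_AE)
  show Tf: "T f \<in> L2_space M" by (rule L2_linear_space[OF T f])
  have le: "L2_norm M (T f) \<le> \<bar>K\<bar> * \<epsilon>" if "\<epsilon> > 0" for \<epsilon>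
  proof -
    obtain F c where F: "finite F" "F \<subseteq> B"
      and less: "L2_norm M (\<lambda>x. f x - (\<Sum>g\<in>F. c g * g x)) < \<epsilon>"
      by (rule L2_orthonormal_basis_approx[OF B f \<open>\<epsilon> > 0\<close>])
    define h where "h = (\<lambda>x. \<Sum>g\<in>F. c g * g x)"
    have FL: "F \<subseteq> L2_space M" using F B by (auto simp: L2_orthonormal_basis_def)
    have h: "h \<in> L2_space M" unfolding h_def by (rule L2_space_sum[OF F(1) FL])
    have fh: "(\<lambda>x. f x - h x) \<in> L2_space M" by (rule L2_space_diff[OF f h])
    have "AE x in M. T h x = 0"
      unfolding h_def by (rule L2_linear_sum_eq_0_AE[OF T F(1) FL]) (use zero F in auto)
    with L2_linear_diff_AE[OF T f h] have "AE x in M. T f x = T (\<lambda>x. f x - h x) x"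
      by eventually_elim simp
    then have "L2_norm M (T f) = L2_norm M (T (\<lambda>x. f x - h x))"
      by (rule L2_norm_cong_AE[OF Tf L2_linear_space[OF T fh]])
    also have "\<dots> \<le> K * L2_norm M (\<lambda>x. f x - h x)" by (rule bound[OF fh])
    also have "\<dots> \<le> \<bar>K\<bar> * L2_norm M (\<lambda>x. f x - h x)"
      by (intro mult_right_mono L2_norm_nonneg) simp
    also have "\<dots> \<le> \<bar>K\<bar> * \<epsilon>"
      using less by (intro mult_left_mono) (auto simp: h_def)
    finally show ?thesis .
  qed
  have "L2_norm M (T f) \<le> 0 + e" if "e > 0" for e
  proof -
    \<comment> \<open>Adding 1 in the denominator covers the case \<open>K = 0\<close>.\<close>
    have "L2_norm M (T f) \<le> \<bar>K\<bar> * (e / (\<bar>K\<bar> + 1))"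
      by (rule le) (use that in simp)
    also have "\<dots> \<le> e" using that by (simp add: field_simps)
    finally show ?thesis by simp
  qed
  then have "L2_norm M (T f) \<le> 0" by (rule field_le_epsilon)
  with L2_norm_nonneg[of M "T f"] show "L2_norm M (T f) = 0" by simp
qed

text \<open>The difference \<open>f - g\<close> has the same norm as its image, which is 0. This
  later cancels the outer \<open>S0\<close>.\<close>

lemma L2_isometry_inj_AE:
  assumes T: "L2_isometry M T" and f: "f \<in> L2_space M" and g: "g \<in> L2_space M"
    and eq: "AE x in M. T f x = T g x"
  shows "AE x in M. f x = g x"
proof -
  have lin: "L2_linear M T" using T by (simp add: L2_isometry_def)
  have fg: "(\<lambda>x. f x - g x) \<in> L2_space M" by (rule L2_space_diff[OF f g])
  have "AE x in M. T (\<lambda>x. f x - g x) x = 0"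
    using L2_linear_diff_AE[OF lin f g] eq by eventually_elim simp
  then have "L2_norm M (T (\<lambda>x. f x - g x)) = L2_norm M (\<lambda>x. 0)"
    by (rule L2_norm_cong_AE[OF L2_linear_space[OF lin fg], rotated]) (simp add: L2_space_def)
  then have "L2_norm M (\<lambda>x. f x - g x) = 0"
    using T fg by (simp add: L2_isometry_def L2_norm_def)
  from L2_norm_eq_0_imp_AE[OF fg this] show ?thesis by simp
qed

section \<open>Self-similar measures and composition with the two branches\<close>

context
  fixes l :: real and M :: "real measure"
  assumes M: "bernoulli_convolution l M"
begin

lemma bernoulli_convolution_sets: "sets M = sets borel"
  using M by (simp add: bernoulli_convolution_def)

lemma bernoulli_convolution_branch_measurable [measurable]:
  "(\<lambda>y. l * (y + \<sigma>)) \<in> measurable M borel"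
  unfolding measurable_cong_sets[OF bernoulli_convolution_sets refl] by measurable

text \<open>Self-similarity writes \<open>M\<close> as the average of the two image measures.
  Dropping one nonnegative summand leaves the other with weight 1/2, hence the factor 2.\<close>

lemma bernoulli_convolution_distr_le:
  assumes "\<sigma> \<in> {1, -1}"
  shows "distr M borel (\<lambda>y. l * (y + \<sigma>)) \<le> scale_measure 2 M"
proof -
  interpret prob_space M using M by (simp add: bernoulli_convolution_def)
  have "emeasure (distr M borel (\<lambda>y. l * (y + \<sigma>))) A \<le> emeasure (scale_measure 2 M) A"
    if A: "A \<in> sets borel" for A
  proof -
    interpret D: prob_space "distr M borel (\<lambda>y. l * (y + \<sigma>))"
      by (rule prob_space_distr) measurable
    have self: "measure M A = 1/2 * measure (distr M borel (\<lambda>x. l * (x + 1))) A +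
        1/2 * measure (distr M borel (\<lambda>x. l * (x - 1))) A"
      using M A by (auto simp: bernoulli_convolution_def)
    have "measure (distr M borel (\<lambda>y. l * (y + \<sigma>))) A \<le> 2 * measure M A"
      using assms unfolding self by auto
    then have "ennreal (measure (distr M borel (\<lambda>y. l * (y + \<sigma>))) A) \<le> ennreal (2 * measure M A)"
      by (rule ennreal_leI)
    also have "\<dots> = 2 * emeasure M A"
      by (simp add: emeasure_eq_measure ennreal_mult)
    finally show ?thesis by (simp add: D.emeasure_eq_measure)
  qed
  then show ?thesis
    by (subst le_measure) (auto simp: bernoulli_convolution_sets)
qed

lemma bernoulli_convolution_AE_branch:
  assumes \<sigma>: "\<sigma> \<in> {1, -1}" and ae: "AE x in M. P x"
  shows "AE y in M. P (l * (y + \<sigma>))"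
proof -
  \<comment> \<open>\<open>P\<close> need not be measurable, so a measurable null set containing its
    exceptional points is used; by domination it is also null for the image measure.\<close>
  obtain N where N: "{x \<in> space M. \<not> P x} \<subseteq> N" "emeasure M N = 0" "N \<in> sets M"
    using AE_E[OF ae] by blast
  have "emeasure (distr M borel (\<lambda>y. l * (y + \<sigma>))) N \<le> emeasure (scale_measure 2 M) N"
    using bernoulli_convolution_distr_le[OF \<sigma>] N
    by (subst (asm) le_measure) (auto simp: bernoulli_convolution_sets)
  then have "emeasure (distr M borel (\<lambda>y. l * (y + \<sigma>))) N = 0" using N by simp
  then have "AE x in distr M borel (\<lambda>y. l * (y + \<sigma>)). P x"
    using N sets_eq_imp_space_eq[OF bernoulli_convolution_sets]
    by (intro AE_I[of _ _ N]) (auto simp: bernoulli_convolution_sets)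
  then show ?thesis by (rule AE_distrD[rotated]) measurable
qed

text \<open>Measurability makes the set where \<open>f\<close> and \<open>g\<close> differ a Borel
  set. Its measure is the average of its measures under the two images, and both of these are
  0.\<close>

lemma bernoulli_convolution_AE_I:
  fixes f g :: "real \<Rightarrow> complex"
  assumes fg: "f \<in> borel_measurable M" "g \<in> borel_measurable M"
    and ae: "\<And>\<sigma>. \<sigma> \<in> {1, -1} \<Longrightarrow> AE y in M. f (l * (y + \<sigma>)) = g (l * (y + \<sigma>))"
  shows "AE x in M. f x = g x"
proof -
  interpret prob_space M using M by (simp add: bernoulli_convolution_def)
  have [measurable]: "f \<in> borel_measurable borel" "g \<in> borel_measurable borel"
    using fg unfolding measurable_cong_sets[OF bernoulli_convolution_sets refl] .
  define N where "N = {x. f x \<noteq> g x}"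
  have N: "N \<in> sets borel" unfolding N_def by measurable
  have zero: "measure (distr M borel (\<lambda>y. l * (y + \<sigma>))) N = 0" if "\<sigma> \<in> {1, -1}" for \<sigma>
  proof -
    interpret D: prob_space "distr M borel (\<lambda>y. l * (y + \<sigma>))"
      by (rule prob_space_distr) measurable
    have "AE x in distr M borel (\<lambda>y. l * (y + \<sigma>)). x \<notin> N"
      unfolding N_def using ae[OF that] by (subst AE_distr_iff) auto
    then show ?thesis using N by (subst D.prob_eq_0) auto
  qed
  have "measure M N = 0"
    using M N zero[of 1] zero[of "-1"] by (auto simp: bernoulli_convolution_def)
  then have "AE x in M. x \<notin> N"
    using N by (subst (asm) prob_eq_0) (auto simp: bernoulli_convolution_sets)
  then show ?thesis by (simp add: N_def)
qed

text \<open>Change of variables followed by domination of the image measure by twice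
  \<open>M\<close>: composition with a branch is bounded on L^2, with norm at most the square root
  of 2.\<close>

lemma bernoulli_convolution_L2_branch:
  assumes \<sigma>: "\<sigma> \<in> {1, -1}" and f: "f \<in> L2_space M"
  shows "(\<lambda>y. f (l * (y + \<sigma>))) \<in> L2_space M"
    and "(L2_norm M (\<lambda>y. f (l * (y + \<sigma>))))\<^sup>2 \<le> 2 * (L2_norm M f)\<^sup>2"
proof -
  have fM[measurable]: "f \<in> borel_measurable M" and int: "integrable M (\<lambda>x. (cmod (f x))\<^sup>2)"
    using f by (auto simp: L2_space_def)
  from fM have [measurable]: "f \<in> borel_measurable borel"
    unfolding measurable_cong_sets[OF bernoulli_convolution_sets refl] .
  \<comment> \<open>Nonnegative integrals are used because integrability of the composite is not
    known yet; the finite bound obtained here yields it.\<close>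
  have "(\<integral>\<^sup>+y. ennreal ((cmod (f (l * (y + \<sigma>))))\<^sup>2) \<partial>M)
      = (\<integral>\<^sup>+x. ennreal ((cmod (f x))\<^sup>2) \<partial>distr M borel (\<lambda>y. l * (y + \<sigma>)))"
    by (subst nn_integral_distr) auto
  also have "\<dots> \<le> (\<integral>\<^sup>+x. ennreal ((cmod (f x))\<^sup>2) \<partial>scale_measure 2 M)"
    by (intro nn_integral_mono_measure bernoulli_convolution_distr_le \<sigma>)
      (simp add: bernoulli_convolution_sets)
  also have "\<dots> = 2 * (\<integral>\<^sup>+x. ennreal ((cmod (f x))\<^sup>2) \<partial>M)"
    by (rule nn_integral_scale_measure) measurable
  also have "\<dots> = ennreal (2 * (LINT x|M. (cmod (f x))\<^sup>2))"
    by (subst nn_integral_eq_integral[OF int]) (auto simp: ennreal_mult)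
  finally have le: "(\<integral>\<^sup>+y. ennreal ((cmod (f (l * (y + \<sigma>))))\<^sup>2) \<partial>M)
      \<le> ennreal (2 * (LINT x|M. (cmod (f x))\<^sup>2))" .
  have int': "integrable M (\<lambda>y. (cmod (f (l * (y + \<sigma>))))\<^sup>2)"
    by (rule integrableI_bounded) (use le in \<open>auto simp: less_top[symmetric] top_unique\<close>)
  then show "(\<lambda>y. f (l * (y + \<sigma>))) \<in> L2_space M" by (auto simp: L2_space_def)
  have "(LINT y|M. (cmod (f (l * (y + \<sigma>))))\<^sup>2) \<le> 2 * (LINT x|M. (cmod (f x))\<^sup>2)"
    using le by (subst (asm) nn_integral_eq_integral[OF int']) auto
  then show "(L2_norm M (\<lambda>y. f (l * (y + \<sigma>))))\<^sup>2 \<le> 2 * (L2_norm M f)\<^sup>2"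
    by (simp add: L2_norm_def)
qed

text \<open>The difference of the two sides is a bounded linear operator in \<open>f\<close> that
  vanishes on the basis \<open>B\<close>, so it vanishes everywhere.\<close>

lemma L2_isometry_branch_eq_AE:
  assumes \<sigma>: "\<sigma> \<in> {1, -1}" and B: "L2_orthonormal_basis M B"
    and S: "L2_isometry M S" and T: "L2_isometry M T" and f: "f \<in> L2_space M"
    and eq: "\<And>e. e \<in> B \<Longrightarrow> AE y in M. S (T e) (l * (y + \<sigma>)) = c * T e y"
  shows "AE y in M. S (T f) (l * (y + \<sigma>)) = c * T f y"
proof -
  define D where "D f = (\<lambda>y. S (T f) (l * (y + \<sigma>)) + (- c) * T f y)" for f
  have lin: "L2_linear M S" "L2_linear M T"
    and iso: "\<And>f. f \<in> L2_space M \<Longrightarrow> L2_norm M (S f) = L2_norm M f"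
      "\<And>f. f \<in> L2_space M \<Longrightarrow> L2_norm M (T f) = L2_norm M f"
    using S T by (auto simp: L2_isometry_def)
  have SL: "S h \<in> L2_space M" and TL: "T h \<in> L2_space M" if "h \<in> L2_space M" for h
    by (rule lin[THEN L2_linear_space, OF that])+
  note branch = bernoulli_convolution_AE_branch[OF \<sigma>]
  have DL: "D h \<in> L2_space M" if h: "h \<in> L2_space M" for h
    unfolding D_def
    by (intro L2_space_add L2_space_mult bernoulli_convolution_L2_branch[OF \<sigma>] SL TL h)
  \<comment> \<open>Both summands carry a factor 2 from the squared estimate for sums. The first
    gains another 2 from the branch, the second the squared modulus of \<open>c\<close>;
    \<open>S\<close> and \<open>T\<close> preserve norms.\<close>
  have bound: "L2_norm M (D h) \<le> sqrt (4 + 2 * (cmod c)\<^sup>2) * L2_norm M h"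
    if h: "h \<in> L2_space M" for h
  proof -
    have "(L2_norm M (D h))\<^sup>2 \<le> 2 * (L2_norm M (\<lambda>y. S (T h) (l * (y + \<sigma>))))\<^sup>2
        + 2 * (L2_norm M (\<lambda>y. (- c) * T h y))\<^sup>2"
      unfolding D_def
      by (intro L2_space_add L2_space_mult bernoulli_convolution_L2_branch[OF \<sigma>] SL TL h)
    also have "\<dots> \<le> 2 * (2 * (L2_norm M (S (T h)))\<^sup>2) + 2 * (L2_norm M (\<lambda>y. (- c) * T h y))\<^sup>2"
      by (intro add_right_mono mult_left_mono bernoulli_convolution_L2_branch[OF \<sigma>] SL TL h) simp
    also have "\<dots> = (4 + 2 * (cmod c)\<^sup>2) * (L2_norm M h)\<^sup>2"
      using L2_space_mult(2)[OF TL[OF h], of "- c"] h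
      by (simp add: iso TL power_mult_distrib algebra_simps)
    also have "\<dots> = (sqrt (4 + 2 * (cmod c)\<^sup>2) * L2_norm M h)\<^sup>2"
      by (simp add: power_mult_distrib)
    finally show ?thesis
      by (rule power2_le_imp_le) (simp add: L2_norm_nonneg)
  qed
  have cong: "AE x in M. S (T u) x = S (T v) x"
    if "u \<in> L2_space M" "v \<in> L2_space M" "AE x in M. T u x = T v x" for u v
    by (rule L2_linear_cong_AE[OF lin(1) TL[OF that(1)] TL[OF that(2)] that(3)])
  have congS: "AE x in M. S u x = S v x"
    if "u \<in> L2_space M" "v \<in> L2_space M" "AE x in M. u x = v x" for u v
    by (rule L2_linear_cong_AE[OF lin(1) that])
  \<comment> \<open>The laws for \<open>T\<close> hold only almost everywhere, so \<open>S\<close>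
    is applied through its almost-everywhere congruence. The resulting identities are then pulled
    back by \<open>branch\<close>, because \<open>D\<close> evaluates \<open>S (T h)\<close> at
    branch points.\<close>
  have D_linear: "L2_linear M D"
    unfolding L2_linear_def
  proof (intro conjI ballI allI impI)
    fix u v assume u: "u \<in> L2_space M" and v: "v \<in> L2_space M"
    { assume "AE x in M. u x = v x"
      then have Tuv: "AE x in M. T u x = T v x"
        by (rule L2_linear_cong_AE[OF lin(2) u v])
      from branch[OF cong[OF u v Tuv]] Tuv
      show "AE x in M. D u x = D v x" unfolding D_def by eventually_elim simp }
    have T_add: "AE x in M. T (\<lambda>y. u y + v y) x = T u x + T v x"
      by (intro L2_linear_add_AE lin u v)
    have "AE x in M. S (T (\<lambda>y. u y + v y)) x = S (\<lambda>x. T u x + T v x) x"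
      by (rule congS[OF _ _ T_add]) (intro TL L2_space_add u v)+
    moreover have "AE x in M. S (\<lambda>x. T u x + T v x) x = S (T u) x + S (T v) x"
      by (intro L2_linear_add_AE lin TL u v)
    ultimately have "AE x in M. S (T (\<lambda>y. u y + v y)) x = S (T u) x + S (T v) x"
      by eventually_elim simp
    from branch[OF this] T_add
    show "AE x in M. D (\<lambda>y. u y + v y) x = D u x + D v x"
      unfolding D_def by eventually_elim (simp add: algebra_simps)
  next
    fix u d assume u: "u \<in> L2_space M"
    have T_mult: "AE x in M. T (\<lambda>y. d * u y) x = d * T u x"
      by (intro L2_linear_mult_AE lin u)
    have "AE x in M. S (T (\<lambda>y. d * u y)) x = S (\<lambda>x. d * T u x) x"
      by (rule congS[OF _ _ T_mult]) (intro TL L2_space_mult u)+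
    moreover have "AE x in M. S (\<lambda>x. d * T u x) x = d * S (T u) x"
      by (intro L2_linear_mult_AE lin TL u)
    ultimately have "AE x in M. S (T (\<lambda>y. d * u y)) x = d * S (T u) x"
      by eventually_elim simp
    from branch[OF this] T_mult
    show "AE x in M. D (\<lambda>y. d * u y) x = d * D u x"
      unfolding D_def by eventually_elim (simp add: algebra_simps)
  qed (rule DL)
  have "AE x in M. D e x = 0" if "e \<in> B" for e
    using eq[OF that] by (simp add: D_def)
  from L2_bounded_linear_eq_0_AE[OF B D_linear f bound this] have "AE x in M. D f x = 0" .
  then show ?thesis by (simp add: D_def)
qed

end

section \<open>Exponentials at the branch points and the arithmetic of \<open>Gam\<close>\<close>

lemma expo_branch:
  assumes "n \<ge> 1"
  shows "expo (2 * real n * t) (1 / (2 * real n) * (y + \<sigma>)) = expo t \<sigma> * expo t y"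
  using assms unfolding expo_def exp_add[symmetric]
  by (intro arg_cong[where f = exp]) (simp add: field_simps)

lemma expo_int:
  assumes "\<sigma> \<in> {1, -1}"
  shows "expo (of_int k) \<sigma> = 1"
proof -
  obtain j :: int where "of_int k * \<sigma> = of_int j"
    using assms by (metis insertE mult.right_neutral mult_minus_right of_int_minus singletonD)
  then have "complex_of_real (of_int k) * of_real \<sigma> = of_int j"
    by (metis of_real_mult of_real_of_int_eq)
  then have "2 * of_real pi * \<i> * of_real (of_int k) * of_real \<sigma>
      = 2 * complex_of_real pi * \<i> * of_int j"
    by (simp add: mult.assoc)
  also have "exp \<dots> = 1"
    using exp_integer_2pi[of "of_int j"] by (simp add: mult_ac)
  finally show ?thesis by (simp add: expo_def)
qed

text \<open>Writing \<open>k = 2 * j + 1\<close> splits off an integer frequency and leaves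
  exp(\<plusminus> i pi). Both choices of \<open>\<sigma>\<close> give the same value, so one sign
  serves for both branches.\<close>

lemma expo_odd_half:
  assumes "\<sigma> \<in> {1, -1}" "odd k"
  shows "expo (of_int k / 2) \<sigma> = -1"
proof -
  obtain j where k: "k = 2 * j + 1" using assms(2) by (elim oddE)
  have "expo (of_int k / 2) \<sigma> = expo (of_int j) \<sigma> * exp (of_real pi * \<i> * of_real \<sigma>)"
    unfolding expo_def exp_add[symmetric] k
    by (intro arg_cong[where f = exp]) (simp add: field_simps)
  also have "\<dots> = -1"
    using assms(1) by (auto simp: expo_int exp_minus)
  finally show ?thesis .
qed

text \<open>Every digit is 0 or n/2, so n/2 factors out of the sum. Consequently 2n times an element
  of \<open>Gam n\<close> is n^2 times a natural number.\<close>

lemma Gam_eq_half_mult: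
  assumes "\<xi> \<in> Gam n"
  obtains k :: nat where "\<xi> = real n / 2 * real k"
proof -
  obtain m a where \<xi>: "\<xi> = (\<Sum>i\<le>m. a i * (2 * real n) ^ i)"
    and a: "\<forall>i\<le>m. a i \<in> {0, real n / 2}"
    using assms unfolding Gam_def by blast
  have "\<xi> = (\<Sum>i\<le>m. real n / 2 * real ((if a i = 0 then 0 else 1) * (2 * n) ^ i))"
    unfolding \<xi> using a by (intro sum.cong) auto
  also have "\<dots> = real n / 2 * real (\<Sum>i\<le>m. (if a i = 0 then 0 else 1) * (2 * n) ^ i)"
    unfolding of_nat_sum sum_distrib_left ..
  finally show thesis by (rule that)
qed

text \<open>Multiplication by 2n moves all digits up one place, and \<open>d\<close> fills the
  vacant place 0.\<close>

lemma Gam_shift: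
  assumes "\<xi> \<in> Gam n" "d \<in> {0, real n / 2}"
  shows "d + 2 * real n * \<xi> \<in> Gam n"
proof -
  obtain m a where \<xi>: "\<xi> = (\<Sum>i\<le>m. a i * (2 * real n) ^ i)"
    and a: "\<forall>i\<le>m. a i \<in> {0, real n / 2}"
    using assms unfolding Gam_def by blast
  have "d + 2 * real n * \<xi> = (\<Sum>i\<le>Suc m. (case i of 0 \<Rightarrow> d | Suc j \<Rightarrow> a j) * (2 * real n) ^ i)"
    unfolding \<xi> sum.atMost_Suc_shift by (simp add: sum_distrib_left mult_ac)
  moreover have "\<forall>i\<le>Suc m. (case i of 0 \<Rightarrow> d | Suc j \<Rightarrow> a j) \<in> {0, real n / 2}"
    using a assms(2) by (auto split: nat.split)
  ultimately show ?thesis unfolding Gam_def by blast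
qed

text \<open>The frequency equals q n^2 k, an integer. The case \<open>q = 1\<close> serves the
  branches of \<open>s\<close>, the case \<open>q = p\<close> those of the left-hand side of the
  theorem.\<close>

lemma expo_mult_Gam_shift_0:
  assumes "\<sigma> \<in> {1, -1}" "\<xi> \<in> Gam n"
  shows "expo (of_int q * (2 * real n * \<xi>)) \<sigma> = 1"
proof -
  obtain k where "\<xi> = real n / 2 * real k" using assms(2) by (rule Gam_eq_half_mult)
  then have "of_int q * (2 * real n * \<xi>) = of_int (q * int (n * n * k))" by simp
  then show ?thesis by (simp only: expo_int[OF assms(1)])
qed

text \<open>The frequency is q (n + 2 n^2 k) / 2, half of an odd integer. Here the oddness of
  \<open>n\<close> and of the multiplier enters.\<close>

lemma expo_mult_Gam_shift_half:
  assumes "\<sigma> \<in> {1, -1}" "\<xi> \<in> Gam n" "odd n" "odd q"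
  shows "expo (of_int q * (real n / 2 + 2 * real n * \<xi>)) \<sigma> = -1"
proof -
  obtain k where "\<xi> = real n / 2 * real k" using assms(2) by (rule Gam_eq_half_mult)
  then have eq: "of_int q * (real n / 2 + 2 * real n * \<xi>)
      = of_int (q * (int n + 2 * int (n * n * k))) / 2"
    by (simp add: field_simps)
  show ?thesis unfolding eq by (rule expo_odd_half[OF assms(1)]) (use assms in simp)
qed

theorem theorem4p4:
  fixes n :: nat and p :: int and M :: "real measure"
    and U S0 S1 :: "(real \<Rightarrow> complex) \<Rightarrow> (real \<Rightarrow> complex)"
    and \<gamma> :: real and s w :: "real \<Rightarrow> complex"
  assumes "n \<ge> 1" and "odd p"
    and "bernoulli_convolution (1 / (2 * real n)) M"
    and "L2_orthonormal_basis M (expo ` Gam n)"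
    and "L2_orthonormal_basis M ((\<lambda>\<gamma>. expo (of_int p * \<gamma>)) ` Gam n)"
    and "L2_unitary M U"
    and "\<forall>\<gamma>\<in>Gam n. AE x in M. U (expo \<gamma>) x = expo (of_int p * \<gamma>) x"
    and "L2_isometry M S0"
    and "\<forall>\<gamma>\<in>Gam n. AE x in M. S0 (expo \<gamma>) x = expo (2 * real n * \<gamma>) x"
    and "L2_isometry M S1"
    and "\<forall>\<gamma>\<in>Gam n. AE x in M. S1 (expo \<gamma>) x = expo (real n / 2 + 2 * real n * \<gamma>) x"
    and "odd n" and "\<gamma> \<in> Gam n"
    and "s \<in> L2_range M (S0 \<circ> S0)" and "w \<in> L2_range M (S0 \<circ> S1)"
    and "AE x in M. S0 (U (expo \<gamma>)) x = s x + w x"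
  shows "(\<gamma> \<in> (\<lambda>\<xi>. 2 * real n * \<xi>) ` Gam n \<longrightarrow>
            (AE x in M. U (S0 (expo \<gamma>)) x = s x - w x)) \<and>
         (\<gamma> \<in> (\<lambda>\<xi>. real n / 2 + 2 * real n * \<xi>) ` Gam n \<longrightarrow>
            (AE x in M. U (S0 (expo \<gamma>)) x = - s x + w x))"
proof -
  let ?l = "1 / (2 * real n)"
  note bc = assms(3) and basis = assms(4)
  have lin0: "L2_linear M S0" and lin1: "L2_linear M S1" and linU: "L2_linear M U"
    using assms(6,8,10) by (auto simp: L2_isometry_def L2_unitary_def)
  have L0: "S0 h \<in> L2_space M" and L1: "S1 h \<in> L2_space M" and LU: "U h \<in> L2_space M"
    if "h \<in> L2_space M" for h
    by (rule lin0[THEN L2_linear_space, OF that] lin1[THEN L2_linear_space, OF that] linU[THEN L2_linear_space, OF that])+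
  have expoL: "expo \<xi> \<in> L2_space M" if "\<xi> \<in> Gam n" for \<xi>
    using basis that by (auto simp: L2_orthonormal_basis_def)
  have shift0: "2 * real n * \<xi> \<in> Gam n" if "\<xi> \<in> Gam n" for \<xi>
    using Gam_shift[OF that, of 0] by simp
  have shift1: "real n / 2 + 2 * real n * \<xi> \<in> Gam n" if "\<xi> \<in> Gam n" for \<xi>
    using Gam_shift[OF that, of "real n / 2"] by simp

  \<comment> \<open>A common form for \<open>T = S0\<close> and \<open>T = S1\<close>:
    \<open>\<phi>\<close> is the action of \<open>T\<close> on frequencies, and \<open>c\<close> is
    the value at \<open>\<sigma>\<close> shared by all exponentials in the image.\<close>
  have branch: "AE y in M. S0 (T h) (?l * (y + \<sigma>)) = c * T h y"
    if \<sigma>: "\<sigma> \<in> {1, -1}" and T: "L2_isometry M T" and h: "h \<in> L2_space M"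
      and Gam: "\<And>\<xi>. \<xi> \<in> Gam n \<Longrightarrow> \<phi> \<xi> \<in> Gam n"
      and T_expo: "\<And>\<xi>. \<xi> \<in> Gam n \<Longrightarrow> AE x in M. T (expo \<xi>) x = expo (\<phi> \<xi>) x"
      and sign: "\<And>\<xi>. \<xi> \<in> Gam n \<Longrightarrow> expo (\<phi> \<xi>) \<sigma> = c"
    for \<sigma> T h \<phi> c
  proof (rule L2_isometry_branch_eq_AE[OF bc \<sigma> basis assms(8) T h])
    fix e assume "e \<in> expo ` Gam n"
    then obtain \<xi> where \<xi>: "\<xi> \<in> Gam n" and e: "e = expo \<xi>" by blast
    have "T e \<in> L2_space M" using T expoL[OF \<xi>] e by (simp add: L2_isometry_def L2_linear_space)
    then have "AE x in M. S0 (T e) x = S0 (expo (\<phi> \<xi>)) x"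
      using T_expo[OF \<xi>] unfolding e
      by (rule L2_linear_cong_AE[OF lin0 _ expoL[OF Gam[OF \<xi>]]])
    moreover have "AE x in M. S0 (expo (\<phi> \<xi>)) x = expo (2 * real n * \<phi> \<xi>) x"
      by (rule bspec[OF assms(9) Gam[OF \<xi>]])
    ultimately have "AE x in M. S0 (T e) x = expo (2 * real n * \<phi> \<xi>) x"
      by eventually_elim simp
    from bernoulli_convolution_AE_branch[OF bc \<sigma> this] T_expo[OF \<xi>]
    show "AE y in M. S0 (T e) (?l * (y + \<sigma>)) = c * T e y"
      by eventually_elim (simp only: expo_branch[OF assms(1)] sign[OF \<xi>] e)
  qed

  obtain f where f: "f \<in> L2_space M" and s: "AE x in M. s x = S0 (S0 f) x"
    and sL: "s \<in> L2_space M"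
    using assms(14) by (auto simp: L2_range_def)
  obtain g where g: "g \<in> L2_space M" and w: "AE x in M. w x = S0 (S1 g) x"
    and wL: "w \<in> L2_space M"
    using assms(15) by (auto simp: L2_range_def)
  have e: "expo \<gamma> \<in> L2_space M" by (rule expoL[OF assms(13)])

  have s_branch: "AE y in M. s (?l * (y + \<sigma>)) = S0 f y" if \<sigma>: "\<sigma> \<in> {1, -1}" for \<sigma>
  proof -
    have "AE y in M. S0 (S0 f) (?l * (y + \<sigma>)) = 1 * S0 f y"
      using assms(9) shift0 expo_mult_Gam_shift_0[OF \<sigma>, where q = 1]
      by (intro branch[OF \<sigma> assms(8) f, where \<phi> = "\<lambda>\<xi>. 2 * real n * \<xi>"]) auto
    with bernoulli_convolution_AE_branch[OF bc \<sigma> s] show ?thesis by eventually_elim simp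
  qed
  have w_branch: "AE y in M. w (?l * (y + \<sigma>)) = - S1 g y" if \<sigma>: "\<sigma> \<in> {1, -1}" for \<sigma>
  proof -
    have "AE y in M. S0 (S1 g) (?l * (y + \<sigma>)) = (-1) * S1 g y"
      using assms(11) shift1 expo_mult_Gam_shift_half[OF \<sigma> _ assms(12), where q = 1]
      by (intro branch[OF \<sigma> assms(10) g, where \<phi> = "\<lambda>\<xi>. real n / 2 + 2 * real n * \<xi>"]) auto
    with bernoulli_convolution_AE_branch[OF bc \<sigma> w] show ?thesis by eventually_elim simp
  qed

  \<comment> \<open>Both sides of the decomposition now lie under \<open>S0\<close>, and injectivity
    removes it, expressing the exponential of frequency p\<gamma> through \<open>f\<close> and
    \<open>g\<close>.\<close>
  have "AE x in M. S0 (\<lambda>x. S0 f x + S1 g x) x = S0 (S0 f) x + S0 (S1 g) x"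
    by (intro L2_linear_add_AE lin0 L0 L1 f g)
  with assms(16) s w have "AE x in M. S0 (U (expo \<gamma>)) x = S0 (\<lambda>x. S0 f x + S1 g x) x"
    by eventually_elim simp
  then have "AE x in M. U (expo \<gamma>) x = S0 f x + S1 g x"
    by (rule L2_isometry_inj_AE[OF assms(8) LU[OF e] L2_space_add(1)[OF L0[OF f] L1[OF g]]])
  moreover have "AE x in M. U (expo \<gamma>) x = expo (of_int p * \<gamma>) x"
    by (rule bspec[OF assms(7,13)])
  ultimately have decomp: "AE y in M. expo (of_int p * \<gamma>) y = S0 f y + S1 g y"
    by eventually_elim simp

  have "AE x in M. S0 (expo \<gamma>) x = expo (2 * real n * \<gamma>) x" by (rule bspec[OF assms(9,13)])
  then have "AE x in M. U (S0 (expo \<gamma>)) x = U (expo (2 * real n * \<gamma>)) x"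
    by (rule L2_linear_cong_AE[OF linU L0[OF e] expoL[OF shift0[OF assms(13)]]])
  moreover have "AE x in M. U (expo (2 * real n * \<gamma>)) x = expo (of_int p * (2 * real n * \<gamma>)) x"
    by (rule bspec[OF assms(7) shift0[OF assms(13)]])
  \<comment> \<open>The factor 2n is moved to the front to match \<open>expo_branch\<close>.\<close>
  ultimately have US0: "AE x in M. U (S0 (expo \<gamma>)) x = expo (2 * real n * (of_int p * \<gamma>)) x"
    by eventually_elim (simp add: mult_ac)

  \<comment> \<open>Checked on each branch: the left side becomes \<open>c\<close> times the
    exponential of frequency p\<gamma>. On the right, \<open>w\<close> contributes
    \<open>- S1 g\<close>, so \<open>s - w\<close> becomes \<open>S0 f + S1 g\<close>, which is that
    exponential by \<open>decomp\<close>.\<close>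
  have main: "AE x in M. U (S0 (expo \<gamma>)) x = c * (s x - w x)"
    if c: "\<And>\<sigma>. \<sigma> \<in> {1, -1} \<Longrightarrow> expo (of_int p * \<gamma>) \<sigma> = c" for c
  proof (rule bernoulli_convolution_AE_I[OF bc])
    show "U (S0 (expo \<gamma>)) \<in> borel_measurable M"
      using LU[OF L0[OF e]] by (simp add: L2_space_def)
    show "(\<lambda>x. c * (s x - w x)) \<in> borel_measurable M"
      using L2_space_mult(1)[OF L2_space_diff[OF sL wL]] by (simp add: L2_space_def)
    fix \<sigma> :: real assume \<sigma>: "\<sigma> \<in> {1, -1}"
    from bernoulli_convolution_AE_branch[OF bc \<sigma> US0] s_branch[OF \<sigma>] w_branch[OF \<sigma>] decomp
    show "AE y in M. U (S0 (expo \<gamma>)) (?l * (y + \<sigma>))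
        = c * (s (?l * (y + \<sigma>)) - w (?l * (y + \<sigma>)))"
      by eventually_elim (simp only: expo_branch[OF assms(1)] c[OF \<sigma>] diff_minus_eq_add)
  qed
  show ?thesis
  proof (intro conjI impI)
    assume "\<gamma> \<in> (\<lambda>\<xi>. 2 * real n * \<xi>) ` Gam n"
    then have "expo (of_int p * \<gamma>) \<sigma> = 1" if "\<sigma> \<in> {1, -1}" for \<sigma>
      using expo_mult_Gam_shift_0[OF that] by blast
    from main[OF this] show "AE x in M. U (S0 (expo \<gamma>)) x = s x - w x" by simp
  next
    assume "\<gamma> \<in> (\<lambda>\<xi>. real n / 2 + 2 * real n * \<xi>) ` Gam n"
    then have "expo (of_int p * \<gamma>) \<sigma> = -1" if "\<sigma> \<in> {1, -1}" for \<sigma>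
      using expo_mult_Gam_shift_half[OF that _ assms(12,2)] by blast
    from main[OF this] show "AE x in M. U (S0 (expo \<gamma>)) x = - s x + w x" by simp
  qed
qed

end
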